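(* Let $(X^{(n)})_{n\ge 1}$ be a sequence of reversible and irreducible continuous time Markov chains with state spaces $S^{(n)}$. A sequence $(f_n)_{n\ge1}$ of Boolean functions, $f_n\colon S^{(n)}\to\{0,1\}$, is noise sensitive with respect to $(X^{(n)})_{n\ge1}$ if and only if for all $k>0$, $$\lim_{n\to\infty}\ \sum_{i\colon \lambda_1^{(n)}\le\lambda_i^{(n)}<k\lambda_1^{(n)}}\hat f_n(i)^2=0.$$
   Context: Each $X^{(n)}=(X^{(n)}_t)_{t\ge0}$ has a finite state space $S^{(n)}$ with $|S^{(n)}|\ge2$, generator $Q_n=(q^{(n)}_{ij})_{i,j\in S^{(n)}}$ and stationary distribution $\pi_n$; $X_0^{(n)}$ is always distributed according to $\pi_n$. For $f,g\colon S^{(n)}\to\mathbb R$, $\langle f,g\rangle=\sum_{w\in S^{(n)}}\pi_n(w)f(w)g(w)$. Let $0=\lambda_0^{(n)}<\lambda_1^{(n)}\le\lambda_2^{(n)}\le\dots\le\lambda^{(n)}_{|S^{(n)}|-1}$ be the eigenvalues of $-Q_n$, with corresponding eigenvectors $\psi_0^{(n)}\equiv 1,\psi_1^{(n)},\dots,\psi^{(n)}_{|S^{(n)}|-1}$ forming an orthonormal basis of the real functions on $S^{(n)}$ with respect to $\langle\cdot,\cdot\rangle$. For $f\colon S^{(n)}\to\mathbb R$ write $\hat f(i)=\langle f,\psi_i^{(n)}\rangle$. The relaxation time is $t_{rel}^{(n)}=1/\lambda_1^{(n)}$. Noise sensitivity: $(f_n)_{n\ge1}$ with $f_n\colon S^{(n)}\to\{0,1\}$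 is noise sensitive with respect to $(X^{(n)})_{n\ge1}$ if for all $\alpha>0$, $\lim_{n\to\infty}\operatorname{Cov}\bigl(f_n(X_0^{(n)}),f_n(X^{(n)}_{\alpha t_{rel}^{(n)}})\bigr)=0$. *)

theory Defs
  imports "HOL-Probability.Probability"
begin

text \<open>Functions and matrices on a finite state space \<open>S :: 'a set\<close> are represented by total
  functions on \<open>'a\<close>; only their values on \<open>S\<close> matter.\<close>

definition is_generator :: "'a set \<Rightarrow> ('a \<Rightarrow> 'a \<Rightarrow> real) \<Rightarrow> bool" where
  "is_generator S Q \<longleftrightarrow>
     (\<forall>i\<in>S. \<forall>j\<in>S. i \<noteq> j \<longrightarrow> Q i j \<ge> 0) \<and> (\<forall>i\<in>S. (\<Sum>j\<in>S. Q i j) = 0)"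

definition irreducible_on :: "'a set \<Rightarrow> ('a \<Rightarrow> 'a \<Rightarrow> real) \<Rightarrow> bool" where
  "irreducible_on S Q \<longleftrightarrow>
     (\<forall>i\<in>S. \<forall>j\<in>S. (i, j) \<in> {(a, b). a \<in> S \<and> b \<in> S \<and> a \<noteq> b \<and> Q a b > 0}\<^sup>*)"

definition stationary_on :: "'a set \<Rightarrow> ('a \<Rightarrow> 'a \<Rightarrow> real) \<Rightarrow> 'a pmf \<Rightarrow> bool" where
  "stationary_on S Q \<pi> \<longleftrightarrow>
     set_pmf \<pi> \<subseteq> S \<and> (\<forall>j\<in>S. (\<Sum>i\<in>S. pmf \<pi> i * Q i j) = 0)"

definition reversible_on :: "'a set \<Rightarrow> ('a \<Rightarrow> 'a \<Rightarrow> real) \<Rightarrow> 'a pmf \<Rightarrow> bool" where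
  "reversible_on S Q \<pi> \<longleftrightarrow> (\<forall>i\<in>S. \<forall>j\<in>S. pmf \<pi> i * Q i j = pmf \<pi> j * Q j i)"

primrec mat_power :: "'a set \<Rightarrow> ('a \<Rightarrow> 'a \<Rightarrow> real) \<Rightarrow> nat \<Rightarrow> 'a \<Rightarrow> 'a \<Rightarrow> real" where
  "mat_power S Q 0 i j = (if i = j then 1 else 0)"
| "mat_power S Q (Suc k) i j = (\<Sum>l\<in>S. Q i l * mat_power S Q k l j)"

text \<open>The transition matrix \<open>P\<^sub>t = exp (t Q)\<close>, entrywise.\<close>

definition transition_matrix ::
    "'a set \<Rightarrow> ('a \<Rightarrow> 'a \<Rightarrow> real) \<Rightarrow> real \<Rightarrow> 'a \<Rightarrow> 'a \<Rightarrow> real" where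
  "transition_matrix S Q t i j = (\<Sum>k. t ^ k / fact k * mat_power S Q k i j)"

text \<open>The process \<open>(X t)\<close>, \<open>t \<ge> 0\<close>, on the probability space \<open>M\<close> is a right-continuous
  continuous-time Markov chain with state space \<open>S\<close>, generator \<open>Q\<close> and initial distribution \<open>\<mu>\<close>:
  its finite-dimensional distributions are those given by the semigroup \<open>exp (t Q)\<close>.
  The state space is discrete, so right-continuity says that paths are locally constant to the right.\<close>

definition markov_chain ::
    "'w measure \<Rightarrow> (real \<Rightarrow> 'w \<Rightarrow> 'a) \<Rightarrow> 'a set \<Rightarrow> ('a \<Rightarrow> 'a \<Rightarrow> real) \<Rightarrow> 'a pmf \<Rightarrow> bool" where
  "markov_chain M X S Q \<mu> \<longleftrightarrow>
     prob_space M \<and>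
     is_generator S Q \<and>
     set_pmf \<mu> \<subseteq> S \<and>
     (\<forall>t\<ge>0. X t \<in> M \<rightarrow>\<^sub>M count_space S) \<and>
     (\<forall>\<omega>\<in>space M. \<forall>t\<ge>0. \<forall>\<^sub>F s in at_right t. X s \<omega> = X t \<omega>) \<and>
     (\<forall>(m::nat) (t :: nat \<Rightarrow> real) (x :: nat \<Rightarrow> 'a).
        t 0 = 0 \<and> (\<forall>k<m. t k < t (Suc k)) \<and> (\<forall>k\<le>m. x k \<in> S) \<longrightarrow>
        measure M {\<omega> \<in> space M. \<forall>k\<le>m. X (t k) \<omega> = x k} =
          pmf \<mu> (x 0) * (\<Prod>k<m. transition_matrix S Q (t (Suc k) - t k) (x k) (x (Suc k))))"

definition inner_on :: "'a set \<Rightarrow> 'a pmf \<Rightarrow> ('a \<Rightarrow> real) \<Rightarrow> ('a \<Rightarrow> real) \<Rightarrow> real" where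
  "inner_on S \<pi> f g = (\<Sum>w\<in>S. pmf \<pi> w * f w * g w)"

text \<open>\<open>lam 0 \<le> lam 1 \<le> \<dots>\<close> are the eigenvalues of \<open>-Q\<close>, with an orthonormal basis of eigenvectors
  \<open>\<psi> 0 \<equiv> 1, \<psi> 1, \<dots>\<close>, indexed by \<open>{..<card S}\<close>. That \<open>lam 0 = 0\<close>, and
  \<open>0 < lam 1\<close> in the irreducible case, are consequences and are not demanded here.\<close>

definition eigenbasis ::
    "'a set \<Rightarrow> ('a \<Rightarrow> 'a \<Rightarrow> real) \<Rightarrow> 'a pmf \<Rightarrow> (nat \<Rightarrow> real) \<Rightarrow> (nat \<Rightarrow> 'a \<Rightarrow> real) \<Rightarrow> bool" where
  "eigenbasis S Q \<pi> lam \<psi> \<longleftrightarrow>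
     (\<forall>i j. i \<le> j \<and> j < card S \<longrightarrow> lam i \<le> lam j) \<and>
     (\<forall>i<card S. \<forall>x\<in>S. (\<Sum>y\<in>S. - Q x y * \<psi> i y) = lam i * \<psi> i x) \<and>
     (\<forall>x\<in>S. \<psi> 0 x = 1) \<and>
     (\<forall>i<card S. \<forall>j<card S. inner_on S \<pi> (\<psi> i) (\<psi> j) = (if i = j then 1 else 0)) \<and>
     (\<forall>f :: 'a \<Rightarrow> real. \<exists>c :: nat \<Rightarrow> real. \<forall>x\<in>S. f x = (\<Sum>i<card S. c i * \<psi> i x))"

definition relaxation_time :: "(nat \<Rightarrow> real) \<Rightarrow> real" where
  "relaxation_time lam = 1 / lam 1"

definition covariance :: "'w measure \<Rightarrow> ('w \<Rightarrow> real) \<Rightarrow> ('w \<Rightarrow> real) \<Rightarrow> real" where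
  "covariance M Y Z =
     (\<integral>\<omega>. (Y \<omega> - (\<integral>\<omega>'. Y \<omega>' \<partial>M)) * (Z \<omega> - (\<integral>\<omega>'. Z \<omega>' \<partial>M)) \<partial>M)"

definition noise_sensitive ::
    "(nat \<Rightarrow> 'w measure) \<Rightarrow> (nat \<Rightarrow> real \<Rightarrow> 'w \<Rightarrow> 'a) \<Rightarrow> (nat \<Rightarrow> real) \<Rightarrow> (nat \<Rightarrow> 'a \<Rightarrow> real) \<Rightarrow> bool" where
  "noise_sensitive M X trel f \<longleftrightarrow>
     (\<forall>\<alpha>>0. (\<lambda>n. covariance (M n) (\<lambda>\<omega>. f n (X n 0 \<omega>)) (\<lambda>\<omega>. f n (X n (\<alpha> * trel n) \<omega>)))
              \<longlonglongrightarrow> 0)"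

end

theory Submission
  imports Defs
begin

text \<open>For one stationary chain write \<open>f^(i) = \<langle>f, \<psi>\<^sub>i\<rangle>\<close>. The semigroup acts on the eigenbasis by
  \<open>P\<^sub>t \<psi>\<^sub>i = exp (- \<lambda>\<^sub>i t) \<psi>\<^sub>i\<close>, and the coefficient at \<open>\<psi>\<^sub>0 = 1\<close> is the mean, so that
  \<open>Cov (f (X\<^sub>0), f (X\<^sub>t)) = \<Sum>i\<ge>1. exp (- \<lambda>\<^sub>i t) f^(i)\<^sup>2\<close> (lemma \<open>covariance_spectral\<close>).
  At \<open>t = \<alpha> / \<lambda>\<^sub>1\<close> the weights become \<open>exp (- \<alpha> \<lambda>\<^sub>i / \<lambda>\<^sub>1)\<close>: each frequency is damped according to its
  size relative to the spectral gap.

  If the covariances tend to 0 for \<open>\<alpha> = 1\<close>, then so does the sum of \<open>f^(i)\<^sup>2\<close> over \<open>\<lambda>\<^sub>1 \<le> \<lambda>\<^sub>i < k \<lambda>\<^sub>1\<close>, because the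
  weights there are at least \<open>exp (- k)\<close> (\<open>low_frequency_mass_le\<close>). Conversely, the frequencies
  above \<open>k \<lambda>\<^sub>1\<close> contribute at most \<open>exp (- \<alpha> k) \<Sum>i. f^(i)\<^sup>2\<close>, which by Parseval's identity and
  \<open>\<bar>f\<bar> \<le> 1\<close> is at most \<open>exp (- \<alpha> k)\<close>, uniformly in the chain (\<open>weighted_mass_le\<close>); sending first
  \<open>n\<close> and then \<open>k\<close> to infinity gives noise sensitivity.

  Rescaling by \<open>\<lambda>\<^sub>1\<close> makes sense because irreducibility forces \<open>\<lambda>\<^sub>1 > 0\<close>: an eigenfunction for the
  eigenvalue 0 is harmonic, hence constant by the maximum principle
  (\<open>harmonic_constant\<close>, \<open>spectral_gap_pos\<close>).\<close>

section \<open>Expansion in the eigenbasis\<close>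

lemma inner_on_cong:
  assumes "\<And>x. x \<in> S \<Longrightarrow> f x = f' x" "\<And>x. x \<in> S \<Longrightarrow> g x = g' x"
  shows "inner_on S \<pi> f g = inner_on S \<pi> f' g'"
  unfolding inner_on_def using assms by (intro sum.cong) auto

lemma inner_on_sum_left:
  "inner_on S \<pi> (\<lambda>x. \<Sum>i\<in>I. c i * h i x) g = (\<Sum>i\<in>I. c i * inner_on S \<pi> (h i) g)"
  unfolding inner_on_def sum_distrib_left sum_distrib_right
  by (subst sum.swap) (intro sum.cong refl, simp add: algebra_simps)

lemma inner_on_diff_const:
  "inner_on S \<pi> (\<lambda>x. f x - c) g = inner_on S \<pi> f g - c * inner_on S \<pi> (\<lambda>_. 1) g"
  unfolding inner_on_def by (simp add: algebra_simps sum_subtractf sum_distrib_left)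

lemma inner_on_commute: "inner_on S \<pi> f g = inner_on S \<pi> g f"
  unfolding inner_on_def by (simp add: mult_ac)

lemma eigenbasis_expansion:
  assumes E: "eigenbasis S Q \<pi> lam \<psi>" and "x \<in> S"
  shows "f x = (\<Sum>i<card S. inner_on S \<pi> f (\<psi> i) * \<psi> i x)"
proof -
  obtain c where c: "\<forall>x\<in>S. f x = (\<Sum>i<card S. c i * \<psi> i x)"
    using E unfolding eigenbasis_def by meson
  have "inner_on S \<pi> f (\<psi> j) = c j" if "j < card S" for j
  proof -
    have "inner_on S \<pi> f (\<psi> j) = inner_on S \<pi> (\<lambda>x. \<Sum>i<card S. c i * \<psi> i x) (\<psi> j)"
      using c by (intro inner_on_cong) auto
    also have "\<dots> = (\<Sum>i<card S. c i * inner_on S \<pi> (\<psi> i) (\<psi> j))"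
      by (rule inner_on_sum_left)
    also have "\<dots> = (\<Sum>i<card S. if i = j then c i else 0)"
      using E that unfolding eigenbasis_def by (intro sum.cong) auto
    also have "\<dots> = c j" using that by simp
    finally show ?thesis .
  qed
  then show ?thesis using c \<open>x \<in> S\<close> by simp
qed

lemma eigenbasis_parseval:
  assumes "eigenbasis S Q \<pi> lam \<psi>"
  shows "inner_on S \<pi> f f = (\<Sum>i<card S. (inner_on S \<pi> f (\<psi> i))\<^sup>2)"
proof -
  have "inner_on S \<pi> f f = inner_on S \<pi> (\<lambda>x. \<Sum>i<card S. inner_on S \<pi> f (\<psi> i) * \<psi> i x) f"
    using eigenbasis_expansion[OF assms] by (intro inner_on_cong) auto
  also have "\<dots> = (\<Sum>i<card S. inner_on S \<pi> f (\<psi> i) * inner_on S \<pi> (\<psi> i) f)"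
    by (rule inner_on_sum_left)
  finally show ?thesis by (simp add: power2_eq_square inner_on_commute)
qed

lemma inner_on_one_eigenvector:
  assumes E: "eigenbasis S Q \<pi> lam \<psi>" and "i < card S"
  shows "inner_on S \<pi> (\<lambda>_. 1) (\<psi> i) = (if i = 0 then 1 else 0)"
proof -
  have "inner_on S \<pi> (\<lambda>_. 1) (\<psi> i) = inner_on S \<pi> (\<psi> 0) (\<psi> i)"
    using E by (intro inner_on_cong) (auto simp: eigenbasis_def)
  then show ?thesis using assms unfolding eigenbasis_def by auto
qed

lemma inner_on_self_le_one:
  assumes E: "eigenbasis S Q \<pi> lam \<psi>" and "card S > 0"
    and f: "\<And>x. x \<in> S \<Longrightarrow> \<bar>f x\<bar> \<le> 1"
  shows "inner_on S \<pi> f f \<le> 1"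
proof -
  have "inner_on S \<pi> f f \<le> inner_on S \<pi> (\<psi> 0) (\<psi> 0)"
    unfolding inner_on_def
  proof (rule sum_mono)
    fix w assume w: "w \<in> S"
    have "f w * f w \<le> 1"
      using f[OF w] by (metis abs_square_le_1 power2_eq_square)
    moreover have "\<psi> 0 w = 1" using E w by (auto simp: eigenbasis_def)
    ultimately show "pmf \<pi> w * f w * f w \<le> pmf \<pi> w * \<psi> 0 w * \<psi> 0 w"
      by (simp add: mult.assoc mult_left_le)
  qed
  also have "\<dots> = 1" using E \<open>card S > 0\<close> unfolding eigenbasis_def by auto
  finally show ?thesis .
qed

section \<open>Spectral form of the semigroup\<close>

text \<open>Induction on the power; the case 0 is the completeness relation of the basis, which is the
  expansion of the point mass at \<open>y\<close>. The factor \<open>\<pi>(y)\<close> arises as the eigenbasis is orthonormal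
  for \<open>\<pi>\<close> and not for counting measure.\<close>

lemma mat_power_spectral:
  assumes "finite S" and E: "eigenbasis S Q \<pi> lam \<psi>" and "y \<in> S"
  shows "x \<in> S \<Longrightarrow>
    mat_power S Q k x y = (\<Sum>i<card S. (- lam i) ^ k * (\<psi> i x * \<psi> i y * pmf \<pi> y))"
proof (induction k arbitrary: x)
  case 0
  have "inner_on S \<pi> (\<lambda>z. if z = y then 1 else 0) (\<psi> i) = \<psi> i y * pmf \<pi> y" for i
  proof -
    have "inner_on S \<pi> (\<lambda>z. if z = y then 1 else 0) (\<psi> i)
        = (\<Sum>z\<in>S. if z = y then pmf \<pi> z * \<psi> i z else 0)"
      unfolding inner_on_def by (intro sum.cong) auto
    then show ?thesis using assms by simp
  qed
  then show ?case
    using eigenbasis_expansion[OF E 0, of "\<lambda>z. if z = y then 1 else 0"] by (simp add: mult_ac)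
next
  case (Suc k)
  have eig: "(\<Sum>z\<in>S. Q x z * \<psi> i z) = - lam i * \<psi> i x" if "i < card S" for i
    using E that Suc.prems unfolding eigenbasis_def
    by (auto simp: sum_negf minus_equation_iff)
  have "mat_power S Q (Suc k) x y
      = (\<Sum>z\<in>S. \<Sum>i<card S. ((- lam i) ^ k * (\<psi> i y * pmf \<pi> y)) * (Q x z * \<psi> i z))"
    by (simp add: Suc.IH sum_distrib_left mult_ac cong: sum.cong)
  also have "\<dots> = (\<Sum>i<card S. ((- lam i) ^ k * (\<psi> i y * pmf \<pi> y)) * (\<Sum>z\<in>S. Q x z * \<psi> i z))"
    by (subst sum.swap) (simp add: sum_distrib_left)
  also have "\<dots> = (\<Sum>i<card S. (- lam i) ^ Suc k * (\<psi> i x * \<psi> i y * pmf \<pi> y))"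
    by (intro sum.cong refl) (simp add: eig mult_ac)
  finally show ?case .
qed

lemma transition_matrix_spectral:
  assumes "finite S" "eigenbasis S Q \<pi> lam \<psi>" "x \<in> S" "y \<in> S"
  shows "transition_matrix S Q t x y
    = (\<Sum>i<card S. exp (- lam i * t) * (\<psi> i x * \<psi> i y * pmf \<pi> y))"
proof -
  have "(\<lambda>k. t ^ k / fact k * mat_power S Q k x y) sums
      (\<Sum>i<card S. exp (- lam i * t) * (\<psi> i x * \<psi> i y * pmf \<pi> y))"
  proof -
    have "(\<lambda>k. \<Sum>i<card S. ((- lam i * t) ^ k /\<^sub>R fact k) * (\<psi> i x * \<psi> i y * pmf \<pi> y)) sums
        (\<Sum>i<card S. exp (- lam i * t) * (\<psi> i x * \<psi> i y * pmf \<pi> y))"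
      by (intro sums_sum sums_mult2 exp_converges)
    also have "(\<lambda>k. \<Sum>i<card S. ((- lam i * t) ^ k /\<^sub>R fact k) * (\<psi> i x * \<psi> i y * pmf \<pi> y))
        = (\<lambda>k. t ^ k / fact k * mat_power S Q k x y)"
      unfolding mat_power_spectral[OF assms(1,2,4,3)] sum_distrib_left
      by (intro ext sum.cong refl) (simp only: power_mult_distrib real_scaleR_def divide_inverse mult_ac)
    finally show ?thesis .
  qed
  then show ?thesis unfolding transition_matrix_def by (rule sums_unique[symmetric])
qed

section \<open>Covariances\<close>

lemma (in prob_space) expectation_finite_range:
  fixes h :: "'b \<Rightarrow> real"
  assumes "finite A" "\<And>\<omega>. \<omega> \<in> space M \<Longrightarrow> Z \<omega> \<in> A"
    and ev: "\<And>a. a \<in> A \<Longrightarrow> {\<omega> \<in> space M. Z \<omega> = a} \<in> events"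
  shows "expectation (\<lambda>\<omega>. h (Z \<omega>)) = (\<Sum>a\<in>A. h a * prob {\<omega> \<in> space M. Z \<omega> = a})"
proof -
  have "expectation (\<lambda>\<omega>. h (Z \<omega>))
      = expectation (\<lambda>\<omega>. \<Sum>a\<in>A. h a * indicator {\<omega> \<in> space M. Z \<omega> = a} \<omega>)"
  proof (intro Bochner_Integration.integral_cong refl)
    fix \<omega> assume w: "\<omega> \<in> space M"
    have "(\<Sum>a\<in>A. h a * indicator {\<omega> \<in> space M. Z \<omega> = a} \<omega>) = (\<Sum>a\<in>A. if a = Z \<omega> then h a else 0)"
      using w by (intro sum.cong) (auto simp: indicator_def)
    then show "h (Z \<omega>) = (\<Sum>a\<in>A. h a * indicator {\<omega> \<in> space M. Z \<omega> = a} \<omega>)"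
      using assms w by simp
  qed
  also have "\<dots> = (\<Sum>a\<in>A. expectation (\<lambda>\<omega>. h a * indicator {\<omega> \<in> space M. Z \<omega> = a} \<omega>))"
    by (intro Bochner_Integration.integral_sum integrable_mult_right integrable_real_indicator ev)
       (simp_all add: emeasure_eq_measure)
  also have "\<dots> = (\<Sum>a\<in>A. h a * prob {\<omega> \<in> space M. Z \<omega> = a})"
    by (intro sum.cong refl) (simp add: Int_def conj_ac)
  finally show ?thesis .
qed

lemma markov_chain_joint_law:
  assumes "markov_chain M X S Q \<mu>" "t > 0" "x \<in> S" "y \<in> S"
  shows "measure M {\<omega> \<in> space M. (X 0 \<omega>, X t \<omega>) = (x, y)} = pmf \<mu> x * transition_matrix S Q t x y"
proof -
  define s where "s k = (if k = 0 then 0 else t)" for k :: nat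
  define z where "z k = (if k = 0 then x else y)" for k :: nat
  have "measure M {\<omega> \<in> space M. \<forall>k\<le>1. X (s k) \<omega> = z k} =
      pmf \<mu> (z 0) * (\<Prod>k<1. transition_matrix S Q (s (Suc k) - s k) (z k) (z (Suc k)))"
  proof -
    have "s 0 = 0 \<and> (\<forall>k<1. s k < s (Suc k)) \<and> (\<forall>k\<le>1. z k \<in> S)"
      using assms by (auto simp: s_def z_def)
    then show ?thesis using assms(1) unfolding markov_chain_def by blast
  qed
  moreover have "{\<omega> \<in> space M. \<forall>k\<le>1. X (s k) \<omega> = z k} = {\<omega> \<in> space M. (X 0 \<omega>, X t \<omega>) = (x, y)}"
    by (auto simp: s_def z_def le_Suc_eq)
  ultimately show ?thesis by (simp add: s_def z_def)
qed

text \<open>Allowing two different functions lets this one formula also give the means of \<open>f (X\<^sub>0)\<close> and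
  \<open>f (X\<^sub>t)\<close>, with the constant 1 as the other function.\<close>

lemma two_time_expectation_spectral:
  assumes "finite S" and mc: "markov_chain M X S Q \<pi>" and E: "eigenbasis S Q \<pi> lam \<psi>" and "t > 0"
  shows "(\<integral>\<omega>. u (X 0 \<omega>) * v (X t \<omega>) \<partial>M)
    = (\<Sum>i<card S. exp (- lam i * t) * (inner_on S \<pi> u (\<psi> i) * inner_on S \<pi> v (\<psi> i)))"
proof -
  interpret prob_space M using mc by (simp add: markov_chain_def)
  have meas: "X s \<in> M \<rightarrow>\<^sub>M count_space S" if "s \<ge> 0" for s
    using mc that by (simp add: markov_chain_def)
  have "(\<integral>\<omega>. u (X 0 \<omega>) * v (X t \<omega>) \<partial>M)
      = (\<integral>\<omega>. (\<lambda>(x, y). u x * v y) (X 0 \<omega>, X t \<omega>) \<partial>M)" by simp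
  also have "\<dots> = (\<Sum>p\<in>S \<times> S. (\<lambda>(x, y). u x * v y) p * prob {\<omega> \<in> space M. (X 0 \<omega>, X t \<omega>) = p})"
  proof (rule expectation_finite_range)
    show "finite (S \<times> S)" using \<open>finite S\<close> by simp
    show "(X 0 \<omega>, X t \<omega>) \<in> S \<times> S" if "\<omega> \<in> space M" for \<omega>
      using meas[of 0] meas[of t] \<open>t > 0\<close> that by (auto dest: measurable_space)
    show "{\<omega> \<in> space M. (X 0 \<omega>, X t \<omega>) = p} \<in> events" if "p \<in> S \<times> S" for p
    proof -
      have "X s -` {a} \<inter> space M \<in> events" if "s \<ge> 0" "a \<in> S" for s a
        using that by (intro measurable_sets[OF meas]) auto
      from this[of 0 "fst p"] this[of t "snd p"]
      have "(X 0 -` {fst p} \<inter> space M) \<inter> (X t -` {snd p} \<inter> space M) \<in> events"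
        using that \<open>t > 0\<close> by (simp add: mem_Times_iff sets.Int)
      also have "(X 0 -` {fst p} \<inter> space M) \<inter> (X t -` {snd p} \<inter> space M)
          = {\<omega> \<in> space M. (X 0 \<omega>, X t \<omega>) = p}" by auto
      finally show ?thesis .
    qed
  qed
  also have "\<dots> = (\<Sum>x\<in>S. \<Sum>y\<in>S. u x * v y * (pmf \<pi> x * transition_matrix S Q t x y))"
    unfolding sum.cartesian_product
    by (intro sum.cong refl) (auto simp: markov_chain_joint_law[OF mc \<open>t > 0\<close>, simplified])
  also have "\<dots> = (\<Sum>x\<in>S. \<Sum>y\<in>S. \<Sum>i<card S.
      exp (- lam i * t) * ((pmf \<pi> x * u x * \<psi> i x) * (pmf \<pi> y * v y * \<psi> i y)))"
    by (intro sum.cong refl)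
       (simp add: transition_matrix_spectral[OF assms(1) E] sum_distrib_left mult_ac)
  also have "\<dots> = (\<Sum>x\<in>S. \<Sum>i<card S. \<Sum>y\<in>S.
      exp (- lam i * t) * ((pmf \<pi> x * u x * \<psi> i x) * (pmf \<pi> y * v y * \<psi> i y)))"
    by (intro sum.cong refl sum.swap)
  also have "\<dots> = (\<Sum>i<card S. \<Sum>x\<in>S. \<Sum>y\<in>S.
      exp (- lam i * t) * ((pmf \<pi> x * u x * \<psi> i x) * (pmf \<pi> y * v y * \<psi> i y)))"
    by (rule sum.swap)
  also have "\<dots> = (\<Sum>i<card S. exp (- lam i * t) * (inner_on S \<pi> u (\<psi> i) * inner_on S \<pi> v (\<psi> i)))"
    unfolding inner_on_def sum_product by (simp add: sum_distrib_left)
  finally show ?thesis .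
qed

lemma eigenvalue_zero:
  assumes "is_generator S Q" "eigenbasis S Q \<pi> lam \<psi>" "finite S" "S \<noteq> {}"
  shows "lam 0 = 0"
proof -
  obtain x where x: "x \<in> S" using assms by auto
  have one: "\<psi> 0 y = 1" if "y \<in> S" for y using assms that by (simp add: eigenbasis_def)
  have "card S > 0" using assms by (simp add: card_gt_0_iff)
  then have "(\<Sum>y\<in>S. - Q x y * \<psi> 0 y) = lam 0 * \<psi> 0 x"
    using assms x unfolding eigenbasis_def by blast
  moreover have "(\<Sum>y\<in>S. - Q x y * \<psi> 0 y) = 0"
    using assms x by (simp add: one is_generator_def sum_negf cong: sum.cong)
  ultimately show ?thesis using one x by simp
qed

text \<open>Both variables have mean \<open>m = \<langle>f, \<psi>\<^sub>0\<rangle>\<close>, and subtracting \<open>m\<close> from \<open>f\<close> removes the coefficient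
  at \<open>\<psi>\<^sub>0\<close> and leaves the others unchanged.\<close>

lemma covariance_spectral:
  assumes "finite S" "S \<noteq> {}" and mc: "markov_chain M X S Q \<pi>"
    and E: "eigenbasis S Q \<pi> lam \<psi>" and "t > 0"
  shows "covariance M (\<lambda>\<omega>. f (X 0 \<omega>)) (\<lambda>\<omega>. f (X t \<omega>))
    = (\<Sum>i\<in>{1..<card S}. exp (- lam i * t) * (inner_on S \<pi> f (\<psi> i))\<^sup>2)"
proof -
  note expect = two_time_expectation_spectral[OF \<open>finite S\<close> mc E \<open>t > 0\<close>]
  have card: "card S > 0" using assms by (simp add: card_gt_0_iff)
  have lam0: "lam 0 = 0" using eigenvalue_zero mc E assms(1,2) by (metis markov_chain_def)
  define m where "m = inner_on S \<pi> f (\<psi> 0)"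
  have m: "(\<Sum>i<card S. exp (- lam i * t) * (if i = 0 then inner_on S \<pi> f (\<psi> i) else 0)) = m"
    using card lam0 by (simp add: m_def if_distrib cong: if_cong)
  have mean0: "(\<integral>\<omega>. f (X 0 \<omega>) \<partial>M) = m"
  proof -
    have "(\<integral>\<omega>. f (X 0 \<omega>) \<partial>M)
        = (\<Sum>i<card S. exp (- lam i * t) * (inner_on S \<pi> f (\<psi> i) * inner_on S \<pi> (\<lambda>_. 1) (\<psi> i)))"
      using expect[of f "\<lambda>_. 1"] by simp
    also have "\<dots> = m"
      unfolding m[symmetric] by (intro sum.cong refl) (simp add: inner_on_one_eigenvector[OF E])
    finally show ?thesis .
  qed
  have meant: "(\<integral>\<omega>. f (X t \<omega>) \<partial>M) = m"
  proof -
    have "(\<integral>\<omega>. f (X t \<omega>) \<partial>M)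
        = (\<Sum>i<card S. exp (- lam i * t) * (inner_on S \<pi> (\<lambda>_. 1) (\<psi> i) * inner_on S \<pi> f (\<psi> i)))"
      using expect[of "\<lambda>_. 1" f] by simp
    also have "\<dots> = m"
      unfolding m[symmetric] by (intro sum.cong refl) (simp add: inner_on_one_eigenvector[OF E])
    finally show ?thesis .
  qed
  have "covariance M (\<lambda>\<omega>. f (X 0 \<omega>)) (\<lambda>\<omega>. f (X t \<omega>))
      = (\<integral>\<omega>. (\<lambda>x. f x - m) (X 0 \<omega>) * (\<lambda>x. f x - m) (X t \<omega>) \<partial>M)"
    unfolding covariance_def mean0 meant by simp
  also have "\<dots> = (\<Sum>i<card S. exp (- lam i * t) * (inner_on S \<pi> (\<lambda>x. f x - m) (\<psi> i))\<^sup>2)"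
    using expect[of "\<lambda>x. f x - m" "\<lambda>x. f x - m"] by (simp add: power2_eq_square)
  also have "\<dots> = (\<Sum>i\<in>{1..<card S}. exp (- lam i * t) * (inner_on S \<pi> (\<lambda>x. f x - m) (\<psi> i))\<^sup>2)"
    using card
    by (intro sum.mono_neutral_right)
       (auto simp: inner_on_diff_const inner_on_one_eigenvector[OF E] m_def)
  also have "\<dots> = (\<Sum>i\<in>{1..<card S}. exp (- lam i * t) * (inner_on S \<pi> f (\<psi> i))\<^sup>2)"
    by (intro sum.cong refl) (simp add: inner_on_diff_const inner_on_one_eigenvector[OF E])
  finally show ?thesis .
qed

section \<open>The spectral gap\<close>

text \<open>Maximum principle: at a maximum of \<open>h\<close> the equation \<open>\<Sum>y. Q x y (h y - h x) = 0\<close> has no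
  positive terms, so the maximum is also attained at every \<open>y\<close> with \<open>Q x y > 0\<close>, and by
  irreducibility it spreads to all of \<open>S\<close>.\<close>

lemma harmonic_constant:
  fixes h :: "'a \<Rightarrow> real"
  assumes "finite S" and gen: "is_generator S Q" and irr: "irreducible_on S Q"
    and harm: "\<And>x. x \<in> S \<Longrightarrow> (\<Sum>y\<in>S. Q x y * h y) = 0"
    and "x \<in> S" "y \<in> S"
  shows "h x = h y"
proof -
  define R where "R = {(a, b). a \<in> S \<and> b \<in> S \<and> a \<noteq> b \<and> Q a b > 0}"
  obtain z where z: "z \<in> S" and max: "\<And>w. w \<in> S \<Longrightarrow> h w \<le> h z"
  proof -
    have "Max (h ` S) \<in> h ` S" using assms by (intro Max_in) auto
    then obtain z where "z \<in> S" "h z = Max (h ` S)" by auto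
    then show ?thesis using that[of z] \<open>finite S\<close> by simp
  qed
  have step: "h b = h z" if "(a, b) \<in> R" "h a = h z" for a b
  proof -
    have ab: "a \<in> S" "b \<in> S" "a \<noteq> b" "Q a b > 0" using that by (auto simp: R_def)
    have "(\<Sum>w\<in>S. Q a w * (h z - h w)) = h z * (\<Sum>w\<in>S. Q a w) - (\<Sum>w\<in>S. Q a w * h w)"
      by (simp add: algebra_simps sum_subtractf sum_distrib_left)
    also have "\<dots> = 0" using gen harm ab by (simp add: is_generator_def)
    finally have zero: "(\<Sum>w\<in>S. Q a w * (h z - h w)) = 0" .
    have "Q a w * (h z - h w) \<ge> 0" if "w \<in> S" for w
      using gen ab max[OF that] that \<open>h a = h z\<close>
      by (cases "w = a") (auto simp: is_generator_def)
    then have "Q a b * (h z - h b) = 0"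
      using zero \<open>finite S\<close> \<open>b \<in> S\<close> by (metis (mono_tags, lifting) sum_nonneg_eq_0_iff)
    then show ?thesis using \<open>Q a b > 0\<close> by simp
  qed
  have "h w = h z" if "w \<in> S" for w
  proof -
    have "(z, w) \<in> R\<^sup>*" using irr z that unfolding irreducible_on_def R_def by blast
    then show ?thesis by (induction rule: rtrancl_induct) (auto intro: step)
  qed
  then show ?thesis using assms by simp
qed

lemma spectral_gap_pos:
  assumes "finite S" "card S \<ge> 2" and gen: "is_generator S Q" and irr: "irreducible_on S Q"
    and E: "eigenbasis S Q \<pi> lam \<psi>"
  shows "lam 1 > 0"
proof (rule ccontr)
  assume "\<not> lam 1 > 0"
  have "S \<noteq> {}" using assms by auto
  then obtain z where z: "z \<in> S" by auto
  have "lam 0 \<le> lam 1" using E assms(2) unfolding eigenbasis_def by auto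
  moreover have "lam 0 = 0" using eigenvalue_zero[OF gen E \<open>finite S\<close> \<open>S \<noteq> {}\<close>] .
  ultimately have "lam 1 = 0" using \<open>\<not> lam 1 > 0\<close> by simp
  have harm: "(\<Sum>y\<in>S. Q x y * \<psi> 1 y) = 0" if "x \<in> S" for x
  proof -
    have "(\<Sum>y\<in>S. - Q x y * \<psi> 1 y) = lam 1 * \<psi> 1 x"
      using E that assms(2) unfolding eigenbasis_def by auto
    then show ?thesis using \<open>lam 1 = 0\<close> by (simp add: sum_negf)
  qed
  have const: "\<psi> 1 x = \<psi> 1 z" if "x \<in> S" for x
    using harmonic_constant[OF \<open>finite S\<close> gen irr harm that z] .
  \<comment> \<open>A constant orthogonal to \<open>\<psi> 0 = 1\<close> vanishes, whereas \<open>\<psi> 1\<close> has norm 1.\<close>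
  have "inner_on S \<pi> (\<psi> 1) g = \<psi> 1 z * inner_on S \<pi> (\<lambda>_. 1) g" for g
    unfolding inner_on_def sum_distrib_left by (intro sum.cong refl) (simp only: const mult_ac mult_1)
  then have "inner_on S \<pi> (\<psi> 1) (\<psi> 1) = 0"
    using inner_on_one_eigenvector[OF E, of 1] assms(2) by simp
  moreover have "inner_on S \<pi> (\<psi> 1) (\<psi> 1) = 1"
    using E assms(2) unfolding eigenbasis_def by auto
  ultimately show False by simp
qed

section \<open>Exponential damping against low-frequency mass\<close>

text \<open>Here \<open>w i\<close> stands for a squared coefficient and \<open>l i\<close> for an eigenvalue.\<close>

lemma low_frequency_mass_le:
  fixes l w :: "nat \<Rightarrow> real"
  assumes "l 0 = 0" "l 1 > 0" "\<And>i. w i \<ge> 0"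
  shows "(\<Sum>i | i < N \<and> l 1 \<le> l i \<and> l i < k * l 1. w i)
    \<le> exp k * (\<Sum>i\<in>{1..<N}. exp (- l i * (1 / l 1)) * w i)"
proof -
  let ?I = "{i. i < N \<and> l 1 \<le> l i \<and> l i < k * l 1}"
  have "(\<Sum>i\<in>?I. w i) \<le> (\<Sum>i\<in>?I. exp k * (exp (- l i * (1 / l 1)) * w i))"
  proof (rule sum_mono)
    fix i assume "i \<in> ?I"
    then have "1 \<le> exp (k - l i * (1 / l 1))" using assms by (simp add: field_simps)
    then have "w i \<le> exp (k - l i * (1 / l 1)) * w i"
      using assms(3) by (simp add: mult_le_cancel_right1 order.strict_iff_not)
    then show "w i \<le> exp k * (exp (- l i * (1 / l 1)) * w i)"
      by (simp add: mult.assoc[symmetric] exp_add[symmetric])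
  qed
  also have "\<dots> \<le> (\<Sum>i\<in>{1..<N}. exp k * (exp (- l i * (1 / l 1)) * w i))"
  proof (rule sum_mono2)
    show "?I \<subseteq> {1..<N}"
    proof
      fix i assume "i \<in> ?I"
      then show "i \<in> {1..<N}" using assms(1,2) by (cases "i = 0") auto
    qed
  qed (use assms(3) in auto)
  finally show ?thesis by (simp add: sum_distrib_left)
qed

lemma weighted_mass_le:
  fixes l w :: "nat \<Rightarrow> real"
  assumes "l 1 > 0" and ord: "\<And>i. 1 \<le> i \<Longrightarrow> i < N \<Longrightarrow> l 1 \<le> l i"
    and "\<And>i. w i \<ge> 0" "(\<Sum>i<N. w i) \<le> 1" "\<alpha> > 0"
  shows "(\<Sum>i\<in>{1..<N}. exp (- l i * (\<alpha> * (1 / l 1))) * w i)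
    \<le> (\<Sum>i | i < N \<and> l 1 \<le> l i \<and> l i < k * l 1. w i) + exp (- \<alpha> * k)"
proof -
  let ?I = "{i. i < N \<and> l 1 \<le> l i \<and> l i < k * l 1}"
  have "(\<Sum>i\<in>{1..<N}. exp (- l i * (\<alpha> * (1 / l 1))) * w i)
      \<le> (\<Sum>i\<in>{1..<N}. (if i \<in> ?I then w i else 0) + exp (- \<alpha> * k) * w i)"
  proof (rule sum_mono)
    fix i assume i: "i \<in> {1..<N}"
    show "exp (- l i * (\<alpha> * (1 / l 1))) * w i \<le> (if i \<in> ?I then w i else 0) + exp (- \<alpha> * k) * w i"
    proof (cases "l i < k * l 1")
      case True
      have "l i \<ge> 0" using ord[of i] i assms(1) by auto
      then have "exp (- l i * (\<alpha> * (1 / l 1))) \<le> 1" using assms by simp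
      then have "exp (- l i * (\<alpha> * (1 / l 1))) * w i \<le> w i" using assms(3) by (intro mult_left_le_one_le) auto
      moreover have "exp (- \<alpha> * k) * w i \<ge> 0" using assms(3) by simp
      ultimately show ?thesis using True i ord[of i] by auto
    next
      case False
      then have "\<alpha> * (k * l 1) \<le> \<alpha> * l i" using assms by (intro mult_left_mono) auto
      then have "exp (- l i * (\<alpha> * (1 / l 1))) \<le> exp (- \<alpha> * k)"
        using assms(1) by (simp add: field_simps)
      then show ?thesis using False assms(3) by (auto intro: mult_right_mono)
    qed
  qed
  also have "\<dots> = (\<Sum>i\<in>{1..<N} \<inter> ?I. w i) + exp (- \<alpha> * k) * (\<Sum>i\<in>{1..<N}. w i)"
    by (simp add: sum.distrib sum_distrib_left sum.inter_restrict)
  also have "\<dots> \<le> (\<Sum>i\<in>?I. w i) + exp (- \<alpha> * k) * 1"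
  proof (intro add_mono mult_left_mono)
    show "(\<Sum>i\<in>{1..<N} \<inter> ?I. w i) \<le> (\<Sum>i\<in>?I. w i)" using assms(3) by (intro sum_mono2) auto
    have "(\<Sum>i\<in>{1..<N}. w i) \<le> (\<Sum>i<N. w i)" using assms(3) by (intro sum_mono2) auto
    then show "(\<Sum>i\<in>{1..<N}. w i) \<le> 1" using assms(4) by simp
  qed simp
  finally show ?thesis by simp
qed

section \<open>Noise sensitivity\<close>

theorem proposition1p4:
  fixes S :: "nat \<Rightarrow> 'a set"
    and Q :: "nat \<Rightarrow> 'a \<Rightarrow> 'a \<Rightarrow> real"
    and \<pi> :: "nat \<Rightarrow> 'a pmf"
    and M :: "nat \<Rightarrow> 'w measure"
    and X :: "nat \<Rightarrow> real \<Rightarrow> 'w \<Rightarrow> 'a"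
    and lam :: "nat \<Rightarrow> nat \<Rightarrow> real"
    and \<psi> :: "nat \<Rightarrow> nat \<Rightarrow> 'a \<Rightarrow> real"
    and f :: "nat \<Rightarrow> 'a \<Rightarrow> real"
  assumes "\<And>n. n \<ge> 1 \<Longrightarrow> finite (S n)"
    and "\<And>n. n \<ge> 1 \<Longrightarrow> card (S n) \<ge> 2"
    and "\<And>n. n \<ge> 1 \<Longrightarrow> markov_chain (M n) (X n) (S n) (Q n) (\<pi> n)"
    and "\<And>n. n \<ge> 1 \<Longrightarrow> irreducible_on (S n) (Q n)"
    and "\<And>n. n \<ge> 1 \<Longrightarrow> stationary_on (S n) (Q n) (\<pi> n)"
    and "\<And>n. n \<ge> 1 \<Longrightarrow> reversible_on (S n) (Q n) (\<pi> n)"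
    and "\<And>n. n \<ge> 1 \<Longrightarrow> eigenbasis (S n) (Q n) (\<pi> n) (lam n) (\<psi> n)"
    and "\<And>n. n \<ge> 1 \<Longrightarrow> f n \<in> S n \<rightarrow> {0, 1}"
  shows "noise_sensitive M X (\<lambda>n. relaxation_time (lam n)) f \<longleftrightarrow>
    (\<forall>k::real. k > 0 \<longrightarrow>
       (\<lambda>n. \<Sum>i \<in> {i. i < card (S n) \<and> lam n 1 \<le> lam n i \<and> lam n i < k * lam n 1}.
              (inner_on (S n) (\<pi> n) (f n) (\<psi> n i))\<^sup>2) \<longlonglongrightarrow> 0)"
proof -
  define w where "w n i = (inner_on (S n) (\<pi> n) (f n) (\<psi> n i))\<^sup>2" for n i
  define mass where
    "mass k n = (\<Sum>i | i < card (S n) \<and> lam n 1 \<le> lam n i \<and> lam n i < k * lam n 1. w n i)" for k n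
  define C where
    "C \<alpha> n = covariance (M n) (\<lambda>\<omega>. f n (X n 0 \<omega>)) (\<lambda>\<omega>. f n (X n (\<alpha> * relaxation_time (lam n)) \<omega>))"
    for \<alpha> n
  have w: "w n i \<ge> 0" for n i by (simp add: w_def)
  have mass_nonneg: "mass k n \<ge> 0" for k n unfolding mass_def by (intro sum_nonneg w)
  have gen: "is_generator (S n) (Q n)" if "n \<ge> 1" for n
    using assms(3)[OF that] by (simp add: markov_chain_def)
  have ne: "S n \<noteq> {}" if "n \<ge> 1" for n using assms(2)[OF that] by auto
  have gap: "lam n 1 > 0" if "n \<ge> 1" for n
    by (rule spectral_gap_pos[OF assms(1)[OF that] assms(2)[OF that] gen[OF that]
          assms(4)[OF that] assms(7)[OF that]])
  have lam0: "lam n 0 = 0" if "n \<ge> 1" for n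
    by (rule eigenvalue_zero[OF gen[OF that] assms(7)[OF that] assms(1)[OF that] ne[OF that]])
  have C_eq: "C \<alpha> n = (\<Sum>i\<in>{1..<card (S n)}. exp (- lam n i * (\<alpha> * (1 / lam n 1))) * w n i)"
    if "n \<ge> 1" "\<alpha> > 0" for n \<alpha>
  proof -
    have "\<alpha> * (1 / lam n 1) > 0" using gap that by simp
    then show ?thesis unfolding C_def relaxation_time_def w_def
      by (rule covariance_spectral[OF assms(1)[OF that(1)] ne[OF that(1)] assms(3)[OF that(1)]
            assms(7)[OF that(1)]])
  qed
  have C_nonneg: "C \<alpha> n \<ge> 0" if "n \<ge> 1" "\<alpha> > 0" for n \<alpha>
    unfolding C_eq[OF that] by (intro sum_nonneg mult_nonneg_nonneg w) simp
  have mass_le: "mass k n \<le> exp k * C 1 n" if "n \<ge> 1" for k n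
    unfolding mass_def using low_frequency_mass_le[OF lam0[OF that] gap[OF that] w] C_eq[OF that, of 1]
    by simp
  have C_le: "C \<alpha> n \<le> mass k n + exp (- \<alpha> * k)" if n: "n \<ge> 1" and "\<alpha> > 0" for \<alpha> k n
    unfolding mass_def C_eq[OF that]
  proof (rule weighted_mass_le)
    show "lam n 1 \<le> lam n i" if "1 \<le> i" "i < card (S n)" for i
      using assms(7)[OF n] that unfolding eigenbasis_def by blast
    have "\<bar>f n x\<bar> \<le> 1" if "x \<in> S n" for x using assms(8)[OF n] that by (fastforce simp: Pi_iff)
    then have "inner_on (S n) (\<pi> n) (f n) (f n) \<le> 1"
      using assms(2)[OF n] by (intro inner_on_self_le_one[OF assms(7)[OF n]]) auto
    then show "(\<Sum>i<card (S n). w n i) \<le> 1"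
      unfolding eigenbasis_parseval[OF assms(7)[OF n]] w_def .
  qed (use gap n w \<open>\<alpha> > 0\<close> in auto)
  have "(\<forall>\<alpha>>0. C \<alpha> \<longlonglongrightarrow> 0) \<longleftrightarrow> (\<forall>k>0. mass k \<longlonglongrightarrow> 0)"
  proof
    assume L: "\<forall>\<alpha>>0. C \<alpha> \<longlonglongrightarrow> 0"
    show "\<forall>k>0. mass k \<longlonglongrightarrow> 0"
    proof (intro allI impI)
      fix k :: real
      have upper: "(\<lambda>n. exp k * C 1 n) \<longlonglongrightarrow> 0"
        using L by (intro tendsto_mult_right_zero) simp
      have "\<forall>\<^sub>F n in sequentially. mass k n \<le> exp k * C 1 n"
        by (rule eventually_sequentiallyI[of 1]) (rule mass_le)
      then show "mass k \<longlonglongrightarrow> 0"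
        using tendsto_sandwich[OF _ _ tendsto_const upper] mass_nonneg by simp
    qed
  next
    assume R: "\<forall>k>0. mass k \<longlonglongrightarrow> 0"
    show "\<forall>\<alpha>>0. C \<alpha> \<longlonglongrightarrow> 0"
    proof (intro allI impI tendstoI)
      fix \<alpha> e :: real assume "\<alpha> > 0" "e > 0"
      \<comment> \<open>The first term of the maximum makes \<open>exp (- \<alpha> k) \<le> e / 2\<close>, the second makes \<open>k\<close> positive.\<close>
      define k where "k = max (- ln (e / 2) / \<alpha>) 1"
      have "- ln (e / 2) / \<alpha> \<le> k" by (simp add: k_def)
      then have "- \<alpha> * k \<le> ln (e / 2)" using \<open>\<alpha> > 0\<close> by (simp add: field_simps)
      then have "exp (- \<alpha> * k) \<le> exp (ln (e / 2))" by (simp only: exp_le_cancel_iff)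
      then have tail: "exp (- \<alpha> * k) \<le> e / 2" using \<open>e > 0\<close> by simp
      have "mass k \<longlonglongrightarrow> 0" using R by (simp add: k_def)
      then have "\<forall>\<^sub>F n in sequentially. mass k n < e / 2"
        using \<open>e > 0\<close> by (intro order_tendstoD) auto
      then show "\<forall>\<^sub>F n in sequentially. dist (C \<alpha> n) 0 < e"
        using eventually_ge_at_top[of 1]
      proof eventually_elim
        case (elim n)
        then show ?case
          using C_le[of n \<alpha> k] C_nonneg[of n \<alpha>] tail \<open>\<alpha> > 0\<close> by simp
      qed
    qed
  qed
  then show ?thesis unfolding noise_sensitive_def C_def mass_def w_def .
qed

end
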